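(* Let $r\ge 2$, let $k$ be an integer with $0\le k\le r-1$, and let $G$ be a finite $(r+1)$-partite $r$-graph in which every partite $(r-1)$-tuple of vertices has strictly balanced degree. If $\max_j\sum_{i\ne j}\rho(i)>r-k-1$, then $G$ contains a copy of $K_{r+1}^r-k$.
   Context: An $r$-graph is an $r$-uniform hypergraph (unweighted). It is $(r+1)$-partite with classes $V_1,\ldots,V_{r+1}$ if every edge has at most one vertex in each class. $P_i$ is the $r$-partite $r$-graph induced by the classes $V_j$, $j\ne i$, and $\rho(i)=|E(P_i)|/\prod_{j\ne i}|V_j|$. A set of vertices is partite if it has at most one vertex in each class. For a partite $(r-1)$-tuple $g$ and a class $V_i$ not meeting $g$, $d(V_i,g)$ is the number of $v\in V_i$ with $g\cup\{v\}\in E(G)$; $g$ has strictly balanced degree if $d(V_i,g)=d(V_j,g)$ for the two classes $V_i,V_j$ not meeting $g$. $K_{r+1}^r$ is the complete $r$-graph on $r+1$ vertices, and $K_{r+1}^r-k$ is the $r$-graph obtained from $K_{r+1}^r$ by deleting any $k$ of its edges (all choices give isomorphic $r$-graphs). *)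

theory Defs
  imports Complex_Main "HOL-Library.Disjoint_Sets"
begin

record 'a hypergraph =
  verts :: "'a set"
  edges :: "'a set set"

definition r_graph :: "nat \<Rightarrow> 'a hypergraph \<Rightarrow> bool" where
  "r_graph r G \<longleftrightarrow> (\<forall>e\<in>edges G. e \<subseteq> verts G \<and> finite e \<and> card e = r)"

definition induced :: "'a hypergraph \<Rightarrow> 'a set \<Rightarrow> 'a hypergraph" where
  "induced G S = \<lparr>verts = verts G \<inter> S, edges = {e \<in> edges G. e \<subseteq> S}\<rparr>"

definition delete_edges :: "'a hypergraph \<Rightarrow> 'a set set \<Rightarrow> 'a hypergraph" where
  "delete_edges G D = \<lparr>verts = verts G, edges = edges G - D\<rparr>"

definition complete_r_graph :: "nat \<Rightarrow> 'a set \<Rightarrow> 'a hypergraph" where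
  "complete_r_graph r A = \<lparr>verts = A, edges = {e. e \<subseteq> A \<and> finite e \<and> card e = r}\<rparr>"

text \<open>A copy is a subgraph that need not be induced.\<close>

definition contains_copy :: "'a hypergraph \<Rightarrow> 'b hypergraph \<Rightarrow> bool" where
  "contains_copy G H \<longleftrightarrow>
    (\<exists>f. inj_on f (verts H) \<and> f ` verts H \<subseteq> verts G \<and> (\<forall>e\<in>edges H. f ` e \<in> edges G))"

text \<open>The classes of an \<open>n\<close>-partite hypergraph are \<open>V 1, \<dots>, V n\<close>; the values
  of \<open>V\<close> at other indices are irrelevant.\<close>

definition partite_set :: "nat \<Rightarrow> (nat \<Rightarrow> 'a set) \<Rightarrow> 'a set \<Rightarrow> bool" where
  "partite_set n V S \<longleftrightarrow>
    S \<subseteq> (\<Union>i\<in>{1..n}. V i) \<and> (\<forall>i\<in>{1..n}. \<forall>x\<in>S \<inter> V i. \<forall>y\<in>S \<inter> V i. x = y)"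

definition partite :: "nat \<Rightarrow> (nat \<Rightarrow> 'a set) \<Rightarrow> 'a hypergraph \<Rightarrow> bool" where
  "partite n V G \<longleftrightarrow>
    disjoint_family_on V {1..n} \<and> (\<Union>i\<in>{1..n}. V i) = verts G \<and>
    (\<forall>e\<in>edges G. partite_set n V e)"

definition part :: "nat \<Rightarrow> (nat \<Rightarrow> 'a set) \<Rightarrow> 'a hypergraph \<Rightarrow> nat \<Rightarrow> 'a hypergraph" where
  "part n V G i = induced G (\<Union>j\<in>{1..n} - {i}. V j)"

text \<open>Classes are allowed to be empty; a density with an empty class in its
  denominator is \<open>0\<close>, by the convention \<open>x / 0 = 0\<close>.\<close>

definition density :: "nat \<Rightarrow> (nat \<Rightarrow> 'a set) \<Rightarrow> 'a hypergraph \<Rightarrow> nat \<Rightarrow> real" where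
  "density n V G i =
    real (card (edges (part n V G i))) / real (\<Prod>j\<in>{1..n} - {i}. card (V j))"

definition degree_into :: "'a hypergraph \<Rightarrow> 'a set \<Rightarrow> 'a set \<Rightarrow> nat" where
  "degree_into G W g = card {v \<in> W. g \<union> {v} \<in> edges G}"

text \<open>For \<open>n = r + 1\<close>, a partite set of size \<open>r - 1\<close> misses exactly two of the \<open>n\<close>
  classes, so the quantification over \<open>i\<close> and \<open>j\<close> compares these two.\<close>

definition strictly_balanced_degree ::
    "nat \<Rightarrow> (nat \<Rightarrow> 'a set) \<Rightarrow> 'a hypergraph \<Rightarrow> 'a set \<Rightarrow> bool" where
  "strictly_balanced_degree n V G g \<longleftrightarrow>
    (\<forall>i\<in>{1..n}. \<forall>j\<in>{1..n}. V i \<inter> g = {} \<and> V j \<inter> g = {} \<longrightarrow>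
      degree_into G (V i) g = degree_into G (V j) g)"

end

theory Submission
  imports Defs "HOL-Analysis.Convex"
begin

text \<open>Fix \<open>j\<close> and draw an edge \<open>e\<close> of \<open>P\<^sub>j\<close> and a vertex \<open>v\<close> of \<open>V\<^sub>j\<close> uniformly and
  independently. Trading the vertex of \<open>e\<close> in \<open>V\<^sub>i\<close> for \<open>v\<close> gives an edge with probability
  at least \<open>\<rho>(i)\<close>: balancedness turns the number of good pairs into a sum of squared
  degrees, to which Cauchy--Schwarz applies. Hence if \<open>\<rho>(i)\<close> sums over \<open>i \<noteq> j\<close> to more
  than \<open>r - k - 1\<close>, some choice of \<open>e\<close> and \<open>v\<close> spans at least \<open>r - k\<close> edges through \<open>v\<close>,
  in addition to \<open>e\<close> itself.\<close>

section \<open>Transversals of families of classes\<close>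

text \<open>Vertex sets instead of choice functions, so that members can be compared directly with
  sets such as \<open>e - V i\<close>.\<close>

definition transversals :: "('i \<Rightarrow> 'a set) \<Rightarrow> 'i set \<Rightarrow> 'a set set" where
  "transversals V J = (\<lambda>f. f ` J) ` Pi\<^sub>E J V"

lemma image_in_transversals:
  assumes "f \<in> Pi J V"
  shows "f ` J \<in> transversals V J"
proof -
  have "restrict f J ` J = f ` J" by simp
  moreover have "restrict f J \<in> Pi\<^sub>E J V" using assms by simp
  ultimately show ?thesis unfolding transversals_def by (metis image_eqI)
qed

lemma transversalsE:
  assumes "g \<in> transversals V J"
  obtains f where "f \<in> Pi J V" "g = f ` J"
  using assms by (auto simp: transversals_def PiE_def)

lemma finite_transversals:
  assumes "finite J" "\<And>j. j \<in> J \<Longrightarrow> finite (V j)"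
  shows "finite (transversals V J)"
  unfolding transversals_def using assms by (simp add: finite_PiE)

text \<open>Passing from choice functions to their images can only merge members; this upper bound
  is the direction in which Cauchy--Schwarz uses the number of cofaces.\<close>

lemma card_transversals_le:
  assumes "finite J" "\<And>j. j \<in> J \<Longrightarrow> finite (V j)"
  shows "card (transversals V J) \<le> (\<Prod>j\<in>J. card (V j))"
  unfolding transversals_def
  using card_image_le[of "Pi\<^sub>E J V" "\<lambda>f. f ` J"] assms by (simp add: finite_PiE card_PiE)

lemma inter_image_selector:
  assumes "disjoint_family_on V N" "J \<subseteq> N" "f \<in> Pi J V" "i \<in> N"
  shows "V i \<inter> f ` J = (if i \<in> J then {f i} else {})"
proof -
  have "l = i" if "l \<in> J" "f l \<in> V i" for l
  proof (rule ccontr)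
    assume "l \<noteq> i"
    moreover have "f l \<in> V l" "l \<in> N" using that(1) assms(2,3) by auto
    ultimately show False
      using assms(1,4) that(2) unfolding disjoint_family_on_def by blast
  qed
  then show ?thesis using assms(3) by auto
qed

lemma inj_on_selector:
  assumes "disjoint_family_on V N" "J \<subseteq> N" "f \<in> Pi J V"
  shows "inj_on f J"
proof (rule inj_onI)
  fix l i assume "l \<in> J" "i \<in> J" "f l = f i"
  then show "l = i"
    using assms unfolding disjoint_family_on_def by (metis IntI Pi_mem empty_iff subsetD)
qed

lemma partite_set_selector:
  assumes "disjoint_family_on V {1..n}" "J \<subseteq> {1..n}" "f \<in> Pi J V"
  shows "partite_set n V (f ` J)"
proof -
  have "\<forall>x\<in>f ` J \<inter> V i. \<forall>y\<in>f ` J \<inter> V i. x = y" if "i \<in> {1..n}" for i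
  proof -
    have "x = f i" if "x \<in> f ` J \<inter> V i" for x
      using that inter_image_selector[OF assms \<open>i \<in> {1..n}\<close>]
      by (metis Int_commute empty_iff singletonD)
    then show ?thesis by metis
  qed
  moreover have "f ` J \<subseteq> (\<Union>i\<in>{1..n}. V i)" using assms(2,3) by blast
  ultimately show ?thesis unfolding partite_set_def by blast
qed

section \<open>Copies of the complete r-graph minus some edges\<close>

text \<open>Glues a bijection from \<open>B\<close> onto an equally large subset of \<open>S\<close>
  to one between the complements; the result serves as a symmetry of the complete r-graph on
  \<open>A\<close>.\<close>

lemma bij_betw_mapping_into:
  assumes "finite A" "B \<subseteq> A" "S \<subseteq> A" "card B \<le> card S"
  obtains p where "bij_betw p A A" "p ` B \<subseteq> S"
proof -
  have fin: "finite B" "finite S" using assms finite_subset by auto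
  obtain S' where S': "S' \<subseteq> S" "card S' = card B"
    using obtain_subset_with_card_n[OF assms(4)] by metis
  have "finite S'" using S' fin finite_subset by auto
  obtain p where p: "bij_betw p B S'"
    using finite_same_card_bij[of B S'] fin \<open>finite S'\<close> S' by auto
  have "card (A - B) = card (A - S')"
    using assms S' fin \<open>finite S'\<close> by (subst (1 2) card_Diff_subset) auto
  then obtain q where q: "bij_betw q (A - B) (A - S')"
    using finite_same_card_bij[of "A - B" "A - S'"] assms(1) by auto
  let ?h = "\<lambda>x. if x \<in> B then p x else q x"
  have "bij_betw ?h (B \<union> (A - B)) (S' \<union> (A - S'))"
    using p q by (intro bij_betw_disjoint_Un) auto
  moreover have "B \<union> (A - B) = A" "S' \<union> (A - S') = A" using assms S' by auto
  moreover have "?h ` B \<subseteq> S" using p S' by (auto simp: bij_betw_def)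
  ultimately show ?thesis using that by metis
qed

lemma complete_r_graph_edge:
  assumes "e \<in> edges (complete_r_graph r A)" "card A = r + 1"
  obtains a where "a \<in> A" "e = A - {a}"
proof -
  have e: "e \<subseteq> A" "finite e" "card e = r" using assms by (auto simp: complete_r_graph_def)
  have "card (A - e) = 1" using e assms(2) by (simp add: card_Diff_subset)
  then obtain a where "A - e = {a}" by (auto simp: card_1_singleton_iff)
  with e show ?thesis using that[of a] by blast
qed

text \<open>Every permutation of \<open>A\<close> is a symmetry of the complete r-graph, so only the
  number of deleted edges matters. With edges indexed by the vertex they omit, a permutation moves
  the indices of the surviving edges into \<open>S\<close>, where \<open>h\<close> is known to give
  edges.\<close>

lemma contains_copy_of_edges:
  fixes h :: "'b \<Rightarrow> 'a"
  assumes "card A = r + 1" "inj_on h A" "h ` A \<subseteq> verts G"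
    and S: "S \<subseteq> A" "\<And>a. a \<in> S \<Longrightarrow> h ` (A - {a}) \<in> edges G"
    and D: "D \<subseteq> edges (complete_r_graph r A)" "r + 1 \<le> card D + card S"
  shows "contains_copy G (delete_edges (complete_r_graph r A) D)"
proof -
  have finA: "finite A" using assms(1) card.infinite by fastforce
  \<comment> \<open>\<open>B\<close> indexes the surviving complement's opposite, the deleted edges,
    so \<open>A - B\<close> has \<open>r + 1 - card D\<close> elements, no more than
    \<open>S\<close>.\<close>
  define B where "B = {a \<in> A. A - {a} \<in> D}"
  have "D = (\<lambda>a. A - {a}) ` B"
    using D(1) complete_r_graph_edge[OF _ assms(1)] unfolding B_def by blast
  moreover have "inj_on (\<lambda>a. A - {a}) B" unfolding B_def inj_on_def by blast
  ultimately have "card B = card D" by (simp add: card_image)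
  moreover have "card (A - B) = card A - card B"
    using finA by (intro card_Diff_subset) (auto simp: B_def)
  ultimately have "card (A - B) \<le> card S" using D(2) assms(1) by simp
  then obtain p where p: "bij_betw p A A" "p ` (A - B) \<subseteq> S"
    using bij_betw_mapping_into[OF finA _ S(1)] by blast
  have pA: "p ` A = A" "inj_on p A" using p(1) by (auto simp: bij_betw_def)
  have "(h \<circ> p) ` e \<in> edges G"
    if e: "e \<in> edges (delete_edges (complete_r_graph r A) D)" for e
  proof -
    have e': "e \<in> edges (complete_r_graph r A)" "e \<notin> D"
      using e by (auto simp: delete_edges_def)
    then obtain a where a: "a \<in> A" "e = A - {a}"
      using complete_r_graph_edge[OF _ assms(1)] by blast
    have "p a \<in> S" using p(2) a e' by (auto simp: B_def)
    moreover have "p ` e = A - {p a}"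
      using inj_on_image_set_diff[OF pA(2), of A "{a}"] a pA(1) by auto
    ultimately show ?thesis using S(2)[of "p a"] by (simp only: image_comp[symmetric])
  qed
  moreover have "inj_on (h \<circ> p) A" using pA assms(2) by (simp add: comp_inj_on)
  moreover have "(h \<circ> p) ` A \<subseteq> verts G" using pA assms(3) by (simp only: image_comp[symmetric])
  ultimately show ?thesis
    unfolding contains_copy_def
    by (intro exI[of _ "h \<circ> p"]) (auto simp: delete_edges_def complete_r_graph_def)
qed

section \<open>Edges of the parts and their cofaces\<close>

locale balanced_partite_hypergraph =
  fixes r :: nat and G :: "'a hypergraph" and V :: "nat \<Rightarrow> 'a set"
  assumes finite_verts: "finite (verts G)"
    and r_graph: "r_graph r G"
    and partite: "partite (r + 1) V G"
    and balanced: "\<And>g. partite_set (r + 1) V g \<Longrightarrow> card g = r - 1 \<Longrightarrow>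
      strictly_balanced_degree (r + 1) V G g"
begin

abbreviation classes :: "nat set" where
  "classes \<equiv> {1..r + 1}"

definition part_edges :: "nat \<Rightarrow> 'a set set" where
  "part_edges i = edges (part (r + 1) V G i)"

text \<open>For distinct classes \<open>i\<close> and \<open>j\<close>, these are the partite
  \<open>(r - 1)\<close>-tuples meeting neither \<open>V i\<close> nor \<open>V j\<close>, that is,
  those whose degrees into these two classes must agree.\<close>

abbreviation cofaces :: "nat \<Rightarrow> nat \<Rightarrow> 'a set set" where
  "cofaces i j \<equiv> transversals V (classes - {i, j})"

lemma disjoint: "disjoint_family_on V classes"
  and Union_classes: "(\<Union>i\<in>classes. V i) = verts G"
  using partite by (auto simp: partite_def)

lemma finite_class: "i \<in> classes \<Longrightarrow> finite (V i)"
  by (rule finite_subset[OF _ finite_verts]) (use Union_classes in blast)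

lemma part_edges_iff:
  "e \<in> part_edges i \<longleftrightarrow> e \<in> edges G \<and> e \<subseteq> (\<Union>l\<in>classes - {i}. V l)"
  by (simp add: part_edges_def part_def induced_def)

lemma finite_part_edges: "finite (part_edges i)"
proof (rule finite_subset)
  show "part_edges i \<subseteq> Pow (verts G)"
    using r_graph by (auto simp: part_edges_iff r_graph_def)
qed (simp add: finite_verts)

text \<open>The edge has \<open>r\<close> vertices, lies in \<open>r\<close> classes and has at most
  one vertex in each. So sending a vertex to its class is a bijection, and its inverse is the
  selector.\<close>

lemma part_edge_selector:
  assumes "j \<in> classes" "e \<in> part_edges j"
  obtains f where "f \<in> Pi (classes - {j}) V" "e = f ` (classes - {j})"
proof -
  let ?L = "classes - {j}"
  have e: "e \<in> edges G" "e \<subseteq> (\<Union>l\<in>?L. V l)" using assms(2) by (auto simp: part_edges_iff)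
  have ce: "card e = r" and ps: "partite_set (r + 1) V e"
    using e(1) r_graph partite by (auto simp: r_graph_def partite_def)
  have "\<forall>x\<in>e. \<exists>l. l \<in> ?L \<and> x \<in> V l" using e(2) by blast
  then obtain c where c: "\<And>x. x \<in> e \<Longrightarrow> c x \<in> ?L \<and> x \<in> V (c x)" by metis
  have "inj_on c e"
  proof (rule inj_onI)
    fix x y assume "x \<in> e" "y \<in> e" "c x = c y"
    then show "x = y" using ps c[of x] c[of y] unfolding partite_set_def
      by (metis Diff_iff IntI)
  qed
  moreover have "c ` e \<subseteq> ?L" using c by blast
  moreover have "card (c ` e) = card ?L"
    using \<open>inj_on c e\<close> ce assms(1) by (simp add: card_image)
  ultimately have bij: "bij_betw c e ?L"
    by (simp add: bij_betw_def card_subset_eq)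
  let ?f = "inv_into e c"
  have "bij_betw ?f ?L e" using bij by (rule bij_betw_inv_into)
  then have im: "e = ?f ` ?L" by (simp add: bij_betw_def)
  have "?f l \<in> V l" if "l \<in> ?L" for l
  proof -
    have "c (?f l) = l" using that bij by (simp add: bij_betw_inv_into_right)
    moreover have "?f l \<in> e" using that im by blast
    ultimately show ?thesis using c by metis
  qed
  with im show ?thesis using that[of ?f] by blast
qed

lemma part_edge_Diff_class:
  assumes "f \<in> Pi (classes - {j}) V" "i \<in> classes"
  shows "f ` (classes - {j}) - V i = f ` (classes - {i, j})"
proof -
  let ?L = "classes - {j}"
  have inj: "inj_on f ?L"
    by (rule inj_on_selector[OF disjoint _ assms(1)]) auto
  \<comment> \<open>The index set \<open>{i} \<inter> ?L\<close> also covers \<open>i = j\<close>,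
    where nothing is removed.\<close>
  have "V i \<inter> f ` ?L = f ` ({i} \<inter> ?L)"
    using inter_image_selector[OF disjoint _ assms] assms(2) by simp
  then have "f ` ?L - V i = f ` ?L - f ` ({i} \<inter> ?L)" by blast
  also have "\<dots> = f ` (?L - {i} \<inter> ?L)"
    by (rule inj_on_image_set_diff[OF inj, symmetric]) auto
  also have "?L - {i} \<inter> ?L = classes - {i, j}" by blast
  finally show ?thesis .
qed

lemma part_edge_Diff_in_cofaces:
  assumes "i \<in> classes" "j \<in> classes" "e \<in> part_edges j"
  shows "e - V i \<in> cofaces i j"
proof -
  obtain f where f: "f \<in> Pi (classes - {j}) V" "e = f ` (classes - {j})"
    using part_edge_selector assms by metis
  have "f \<in> Pi (classes - {i, j}) V" using f(1) by (auto simp: Pi_def)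
  then show ?thesis
    using part_edge_Diff_class[OF f(1) assms(1)] f(2) image_in_transversals by metis
qed

section \<open>Double counting of edges through cofaces\<close>

text \<open>An edge of the part has exactly one vertex in \<open>V i\<close>, so it is recovered
  from \<open>g\<close> by adding that vertex; distinct vertices give distinct edges because
  \<open>g\<close> misses \<open>V i\<close>.\<close>

lemma coface_fibre:
  assumes "i \<in> classes" "j \<in> classes" "i \<noteq> j" "g \<in> cofaces i j"
  shows "card {e \<in> part_edges j. e - V i = g} = degree_into G (V i) g"
proof -
  obtain f where f: "f \<in> Pi (classes - {i, j}) V" "g = f ` (classes - {i, j})"
    using transversalsE assms(4) by metis
  have gV: "V i \<inter> g = {}"
    unfolding f(2) using inter_image_selector[OF disjoint _ f(1) assms(1)] by auto
  have gsub: "g \<subseteq> (\<Union>l\<in>classes - {i, j}. V l)" using f by (auto simp: Pi_def)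
  let ?W = "{v \<in> V i. g \<union> {v} \<in> edges G}"
  have "{e \<in> part_edges j. e - V i = g} = (\<lambda>v. g \<union> {v}) ` ?W"
  proof (intro equalityI subsetI)
    fix e assume "e \<in> {e \<in> part_edges j. e - V i = g}"
    then have e: "e \<in> part_edges j" "e - V i = g" by auto
    obtain f' where f': "f' \<in> Pi (classes - {j}) V" "e = f' ` (classes - {j})"
      using part_edge_selector assms(2) e(1) by metis
    have "V i \<inter> e = {f' i}"
      unfolding f'(2) using inter_image_selector[OF disjoint _ f'(1) assms(1)] assms(1,3) by auto
    then have "e = g \<union> {f' i}" "f' i \<in> V i" using e(2) by blast+
    then show "e \<in> (\<lambda>v. g \<union> {v}) ` ?W" using e(1) by (auto simp: part_edges_iff)
  next
    fix e assume "e \<in> (\<lambda>v. g \<union> {v}) ` ?W"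
    then obtain v where v: "e = g \<union> {v}" "v \<in> V i" "e \<in> edges G" by auto
    have "e \<subseteq> (\<Union>l\<in>classes - {j}. V l)" using v gsub assms by auto
    moreover have "e - V i = g" using v gV by auto
    ultimately show "e \<in> {e \<in> part_edges j. e - V i = g}" using v by (simp add: part_edges_iff)
  qed
  moreover have "inj_on (\<lambda>v. g \<union> {v}) ?W" using gV by (auto simp: inj_on_def)
  ultimately show ?thesis by (simp add: card_image degree_into_def)
qed

lemma finite_cofaces: "finite (cofaces i j)"
  by (rule finite_transversals) (auto intro: finite_class)

text \<open>Groups the edges by their coface. The weight 1 will count edges; the degree into
  \<open>V j\<close> as weight will give, by balancedness, a sum of squared degrees.\<close>

lemma sum_part_edges_by_coface:
  fixes w :: "'a set \<Rightarrow> nat"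
  assumes "i \<in> classes" "j \<in> classes" "i \<noteq> j"
  shows "(\<Sum>e\<in>part_edges j. w (e - V i)) = (\<Sum>g\<in>cofaces i j. degree_into G (V i) g * w g)"
proof -
  have "(\<Sum>e\<in>part_edges j. w (e - V i)) =
    (\<Sum>g\<in>cofaces i j. \<Sum>e\<in>{e \<in> part_edges j. e - V i = g}. w (e - V i))"
    by (rule sum.group[symmetric])
      (use finite_part_edges finite_cofaces part_edge_Diff_in_cofaces assms in auto)
  also have "\<dots> = (\<Sum>g\<in>cofaces i j. degree_into G (V i) g * w g)"
    by (intro sum.cong refl) (simp add: coface_fibre[OF assms, symmetric])
  finally show ?thesis .
qed

lemma coface_balanced:
  assumes "i \<in> classes" "j \<in> classes" "i \<noteq> j" "g \<in> cofaces i j"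
  shows "degree_into G (V i) g = degree_into G (V j) g"
proof -
  let ?L = "classes - {i, j}"
  obtain f where f: "f \<in> Pi ?L V" "g = f ` ?L" using transversalsE assms(4) by metis
  have "?L \<subseteq> classes" by auto
  note sel = disjoint this f(1)
  have "card ?L = r - 1" using assms by (subst card_Diff_subset) auto
  then have "card g = r - 1" using inj_on_selector[OF sel] by (simp add: f(2) card_image)
  moreover have "partite_set (r + 1) V g" unfolding f(2) by (rule partite_set_selector[OF sel])
  ultimately have sb: "strictly_balanced_degree (r + 1) V G g" by (intro balanced)
  have "V l \<inter> g = {}" if "l \<in> {i, j}" "l \<in> classes" for l
    unfolding f(2) using inter_image_selector[OF sel that(2)] that(1) by auto
  then have "V i \<inter> g = {} \<and> V j \<inter> g = {}" using assms(1,2) by simp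
  then show ?thesis
    by (rule bspec[OF bspec[OF sb[unfolded strictly_balanced_degree_def] assms(1)] assms(2), THEN mp])
qed

lemma card_part_edges:
  assumes "i \<in> classes" "j \<in> classes" "i \<noteq> j"
  shows "card (part_edges j) = (\<Sum>g\<in>cofaces i j. degree_into G (V i) g)"
  using sum_part_edges_by_coface[OF assms, of "\<lambda>_. 1"] by (simp only: card_eq_sum mult_1_right)

text \<open>Both parts are counted through the same cofaces, one by degrees into \<open>V j\<close>
  and the other by degrees into \<open>V i\<close>; balancedness equates these degrees.\<close>

lemma card_part_edges_eq:
  assumes "i \<in> classes" "j \<in> classes"
  shows "card (part_edges i) = card (part_edges j)"
proof (cases "i = j")
  case False
  have "card (part_edges i) = (\<Sum>g\<in>cofaces j i. degree_into G (V j) g)"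
    by (rule card_part_edges) (use assms False in auto)
  also have "\<dots> = (\<Sum>g\<in>cofaces i j. degree_into G (V i) g)"
    unfolding insert_commute[of j i] using coface_balanced[OF assms False] by (intro sum.cong) auto
  finally show ?thesis by (simp only: card_part_edges[OF assms False])
qed simp

text \<open>Cauchy--Schwarz: by balancedness the left-hand sum is \<open>\<Sum>g. d g ^ 2\<close> over the
  cofaces \<open>g\<close>, while both edge sets have \<open>\<Sum>g. d g\<close> elements.\<close>

lemma sum_degree_ge_density:
  assumes "i \<in> classes" "j \<in> classes" "i \<noteq> j"
  shows "real (card (part_edges j)) * real (card (V j)) * density (r + 1) V G i
    \<le> real (\<Sum>e\<in>part_edges j. degree_into G (V j) (e - V i))"
proof -
  let ?d = "\<lambda>g. real (degree_into G (V i) g)"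
  let ?T = "cofaces i j"
  define m where "m = real (card (part_edges j))"
  define P where "P = real (\<Prod>l\<in>classes - {i, j}. card (V l))"
  define A where "A = (\<Sum>g\<in>?T. (?d g)\<^sup>2)"
  have A: "real (\<Sum>e\<in>part_edges j. degree_into G (V j) (e - V i)) = A"
    using sum_part_edges_by_coface[OF assms, of "degree_into G (V j)"] coface_balanced[OF assms]
    by (simp add: A_def power2_eq_square)
  have "0 \<le> A" unfolding A_def by (intro sum_nonneg) simp
  have m: "m = (\<Sum>g\<in>?T. ?d g)" using card_part_edges[OF assms] by (simp add: m_def)
  have "m\<^sup>2 \<le> A * real (card ?T)"
    using Cauchy_Schwarz_ineq_sum[of ?d "\<lambda>_. 1" ?T] by (simp add: m A_def)
  also have "\<dots> \<le> A * P"
    using card_transversals_le[of "classes - {i, j}" V] finite_class \<open>0 \<le> A\<close>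
    unfolding P_def by (intro mult_left_mono of_nat_mono) auto
  finally have mA: "m\<^sup>2 \<le> A * P" .
  \<comment> \<open>Omitting \<open>V i\<close> leaves \<open>V j\<close> and the classes of the
    cofaces, so the denominator is \<open>card (V j)\<close> times \<open>P\<close>; the numerator
    is \<open>m\<close> because all parts have equally many edges.\<close>
  have "classes - {i} = insert j (classes - {i, j})" using assms by auto
  then have "density (r + 1) V G i = m / (real (card (V j)) * P)"
    using card_part_edges_eq[OF assms(1,2)] by (simp add: density_def part_edges_def m_def P_def)
  \<comment> \<open>Equality holds unless \<open>V j\<close> is empty, in which case the left side
    is 0.\<close>
  then have "m * real (card (V j)) * density (r + 1) V G i \<le> m\<^sup>2 / P"
    by (cases "card (V j) = 0") (auto simp: power2_eq_square P_def intro!: divide_nonneg_nonneg prod_nonneg)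
  also have "\<dots> \<le> A"
  \<comment> \<open>For \<open>P = 0\<close> the quotient is 0 by convention, and \<open>A\<close>
    is nonnegative.\<close>
  proof (cases "P = 0")
    case False
    moreover have "0 \<le> P" unfolding P_def by (rule of_nat_0_le_iff)
    ultimately have "0 < P" by simp
    then show ?thesis using mA by (simp add: divide_le_eq)
  qed (simp add: \<open>0 \<le> A\<close>)
  finally show ?thesis using A m_def by simp
qed

section \<open>Averaging and construction of the copy\<close>

lemma edge_vertex_pair:
  assumes j: "j \<in> classes" and c: "0 \<le> c" "c < (\<Sum>i\<in>classes - {j}. density (r + 1) V G i)"
  obtains e v where "e \<in> part_edges j" "v \<in> V j"
    "c < real (card {i \<in> classes - {j}. (e - V i) \<union> {v} \<in> edges G})"
proof -
  let ?E = "part_edges j" and ?I = "classes - {j}"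
  let ?S = "\<lambda>e v. {i \<in> ?I. (e - V i) \<union> {v} \<in> edges G}"
  \<comment> \<open>Since \<open>c\<close> is nonnegative, the density sum is positive. A nonzero
    density at some \<open>i\<close> other than \<open>j\<close> forces \<open>V j\<close> and all
    edge sets of parts to be nonempty, so multiplying by \<open>pos\<close> keeps the inequality
    strict.\<close>
  have "\<exists>i\<in>?I. density (r + 1) V G i \<noteq> 0" 
  proof (rule ccontr)
    assume "\<not> ?thesis"
    then have "(\<Sum>i\<in>?I. density (r + 1) V G i) = 0" by (intro sum.neutral) blast
    with c show False by linarith
  qed
  then obtain i where i: "i \<in> ?I" "density (r + 1) V G i \<noteq> 0" by blast
  have "card (part_edges i) \<noteq> 0" "card (V j) \<noteq> 0"
    using i j by (auto simp: density_def part_edges_def)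
  then have pos: "0 < real (card ?E) * real (card (V j))"
    using card_part_edges_eq[of i j] i j by (simp add: zero_less_mult_iff)
  have fV: "finite (V j)" using finite_class j by blast
  have "real (card ?E) * real (card (V j)) * c
      < real (card ?E) * real (card (V j)) * (\<Sum>i\<in>?I. density (r + 1) V G i)"
    using pos c(2) by (rule mult_strict_left_mono[rotated])
  also have "\<dots> \<le> (\<Sum>i\<in>?I. real (\<Sum>e\<in>?E. degree_into G (V j) (e - V i)))"
    unfolding sum_distrib_left using sum_degree_ge_density j by (intro sum_mono) auto
  also have "\<dots> = real (\<Sum>e\<in>?E. \<Sum>i\<in>?I. degree_into G (V j) (e - V i))"
    unfolding of_nat_sum by (rule sum.swap)
  \<comment> \<open>For fixed \<open>e\<close>, both inner sums count the pairs of \<open>i\<close>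
    and \<open>v\<close> for which trading the vertex in \<open>V i\<close> for \<open>v\<close>
    gives an edge.\<close>
  also have "(\<Sum>e\<in>?E. \<Sum>i\<in>?I. degree_into G (V j) (e - V i)) = (\<Sum>e\<in>?E. \<Sum>v\<in>V j. card (?S e v))"
    unfolding degree_into_def by (intro sum.cong refl sum_multicount_gen) (simp_all add: fV)
  finally have less: "real (card ?E) * real (card (V j)) * c
      < (\<Sum>e\<in>?E. \<Sum>v\<in>V j. real (card (?S e v)))" by simp
  have "\<exists>e\<in>?E. \<exists>v\<in>V j. c < real (card (?S e v))"
  proof (rule ccontr)
    assume "\<not> ?thesis"
    then have "(\<Sum>e\<in>?E. \<Sum>v\<in>V j. real (card (?S e v))) \<le> (\<Sum>e\<in>?E. \<Sum>v\<in>V j. c)"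
      by (intro sum_mono) (auto simp: not_less)
    with less show False by simp
  qed
  then show ?thesis using that by blast
qed

text \<open>The selector of \<open>e\<close>, extended by \<open>v\<close> at \<open>j\<close>,
  embeds the \<open>r + 1\<close> indices: omitting \<open>j\<close> gives \<open>e\<close>, and
  omitting another \<open>i\<close> gives \<open>e\<close> with its vertex in \<open>V i\<close>
  traded for \<open>v\<close>.\<close>

lemma contains_copy_of_dense:
  assumes j: "j \<in> classes"
    and dens: "real r - real k - 1 < (\<Sum>i\<in>classes - {j}. density (r + 1) V G i)"
    and "k < r"
    and D: "D \<subseteq> edges (complete_r_graph r classes)" "card D = k"
  shows "contains_copy G (delete_edges (complete_r_graph r classes) D)"
proof -
  have nonneg: "0 \<le> real r - real k - 1" using \<open>k < r\<close> by linarith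
  obtain e v where e: "e \<in> part_edges j" and v: "v \<in> V j"
    and many: "real r - real k - 1 < real (card {i \<in> classes - {j}. (e - V i) \<union> {v} \<in> edges G})"
    by (rule edge_vertex_pair[OF j nonneg dens])
  obtain f where f: "f \<in> Pi (classes - {j}) V" "e = f ` (classes - {j})"
    using part_edge_selector[OF j e] by blast
  define h where "h = f(j := v)"
  let ?S = "{i \<in> classes - {j}. (e - V i) \<union> {v} \<in> edges G}"
  have h: "h \<in> Pi classes V" using f(1) v by (auto simp: h_def Pi_def)
  have edge: "h ` (classes - {i}) \<in> edges G" if "i \<in> insert j ?S" for i
  proof (cases "i = j")
    case True
    have "h ` (classes - {j}) = e" unfolding f(2) by (auto simp: h_def)
    then show ?thesis using True e by (simp add: part_edges_iff)
  next
    case False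
    with that have i: "i \<in> classes" "(e - V i) \<union> {v} \<in> edges G" by auto
    have "classes - {i} = insert j (classes - {i, j})" using False j by auto
    then have "h ` (classes - {i}) = f ` (classes - {i, j}) \<union> {v}" by (auto simp: h_def)
    then show ?thesis using i part_edge_Diff_class[OF f(1) i(1)] f(2) by simp
  qed
  have inj: "inj_on h classes" using inj_on_selector[OF disjoint _ h] by simp
  have sub: "h ` classes \<subseteq> verts G"
    unfolding Union_classes[symmetric] using h by (auto simp: Pi_def)
  \<comment> \<open>A cardinality strictly above \<open>r - k - 1\<close> is at least
    \<open>r - k\<close>; the index \<open>j\<close> of \<open>e\<close> itself adds one, and the
    \<open>k\<close> deleted edges bring the total to \<open>r + 1\<close>.\<close>
  have le: "r + 1 \<le> card D + card (insert j ?S)" using many D(2) by simp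
  show ?thesis
  proof (rule contains_copy_of_edges[where S = "insert j ?S" and h = h])
    show "insert j ?S \<subseteq> classes" using j by blast
    show "h ` (classes - {i}) \<in> edges G" if "i \<in> insert j ?S" for i using that by (rule edge)
  qed (simp, (rule inj sub D(1) le)+)
qed

end

theorem theorem3p7:
  fixes r k :: nat and G :: "'a hypergraph" and V :: "nat \<Rightarrow> 'a set"
  assumes "r \<ge> 2" and "k \<le> r - 1"
    and "finite (verts G)" and "r_graph r G" and "partite (r + 1) V G"
    and "\<And>g. partite_set (r + 1) V g \<Longrightarrow> card g = r - 1 \<Longrightarrow>
           strictly_balanced_degree (r + 1) V G g"
    and "Max ((\<lambda>j. \<Sum>i\<in>{1..r + 1} - {j}. density (r + 1) V G i) ` {1..r + 1})
           > real r - real k - 1"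
  shows "\<forall>D. D \<subseteq> edges (complete_r_graph r {1..r + 1}) \<and> card D = k \<longrightarrow>
           contains_copy G (delete_edges (complete_r_graph r {1..r + 1}) D)"
proof -
  have G: "balanced_partite_hypergraph r G V"
    by (rule balanced_partite_hypergraph.intro) (fact assms(3-6))+
  let ?s = "\<lambda>j. \<Sum>i\<in>{1..r + 1} - {j}. density (r + 1) V G i"
  have "Max (?s ` {1..r + 1}) \<in> ?s ` {1..r + 1}" by (rule Max_in) simp_all
  then obtain j where j: "j \<in> {1..r + 1}" "Max (?s ` {1..r + 1}) = ?s j" by (rule imageE)
  \<comment> \<open>The subtraction \<open>r - 1\<close> is on naturals; \<open>r \<ge> 2\<close>
    keeps it from truncating.\<close>
  have "k < r" using assms(1,2) by linarith
  then show ?thesis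
    using balanced_partite_hypergraph.contains_copy_of_dense[OF G j(1) assms(7)[unfolded j(2)]]
    by blast
qed

end
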